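(* For any given $\{V,a\}$ and $\{V_i,a_i\}_{i\in\mathbb{N}}$ (with operators $R_i:V_i\to V$) as in the context and any discrete probability measure $\rho$ on $\mathbb{N}$ with $\rho_i:=\rho(\{i\})>0$, the following continuous embeddings hold with norm $\le 1$: $$\mathcal{A}_\infty^{\rho}\subset A_2=\mathcal{A}_2^{\sqrt{\rho}}\subset\mathcal{A}_1.$$
   Context: Setting. $V$ is a separable real Hilbert space equipped with the scalar product $a(\cdot,\cdot)$ and norm $\|v\|=a(v,v)^{1/2}$. For each $i\in\mathbb{N}$, $V_i$ is a separable real Hilbert space with scalar product $a_i(\cdot,\cdot)$ and norm $\|v_i\|_i=a_i(v_i,v_i)^{1/2}$, and $R_i:V_i\to V$ is a linear operator with $\mathrm{Ker}(R_i)=\{0\}$ and $\sup_{\|v_i\|_i=1}\|R_iv_i\|\le\Lambda$, with a constant $\Lambda<\infty$ independent of $i$. The class $A_2$ (depending on $\rho$) consists of all $u\in V$ for which there exist $v_i\in V_i$ with $$u=\sum_i\rho_iR_iv_i,\qquad\sum_i\rho_i\|v_i\|_i^2<\infty,$$ with norm $\|u\|_{A_2}^2=\inf\sum_i\rho_i\|v_i\|_i^2$, the infimum being over all such representations $u=\sum_i\rho_iR_iv_i$. For a sequence $\gamma=\{\gamma_i>0\}_{i\in\mathbb{N}}$ and $0<q\le\infty$, the class $\mathcal{A}_q^\gamma$ consists of all $u\in V$ for which there exist $w_i\in V_i$ with $$u=\sum_iR_iw_i,\qquad\big\|\{\gamma_i^{-1}\|w_i\|_i\}_i\big\|_{\ell_q}<\infty,$$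 with (quasi-)norm $\|u\|_{\mathcal{A}_q^\gamma}=\inf\big\|\{\gamma_i^{-1}\|w_i\|_i\}_i\big\|_{\ell_q}$, the infimum being over all such representations of $u$. Here $\rho$ in $\mathcal{A}_\infty^\rho$ stands for the sequence $\{\rho_i\}$, $\sqrt\rho$ for the sequence $\{\sqrt{\rho_i}\}$, and $\mathcal{A}_q:=\mathcal{A}_q^{\mathbf 1}$ for the constant sequence $\gamma_i=1$. An embedding $X\subset Y$ holds with norm $\le1$ if every $u\in X$ belongs to $Y$ and $\|u\|_Y\le\|u\|_X$; equality means that both embeddings hold with norm $\le 1$. *)

theory Defs
  imports "HOL-Analysis.Analysis" "HOL-Probability.Probability_Mass_Function"
begin

text \<open>
  A family of Hilbert spaces cannot be indexed by a type, so each member of the family is given by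
  a linear subspace of a common real vector space (with no topology of its own), together with
  its own scalar product. Any sequence of real vector spaces can be presented in this way, for
  instance inside its direct sum. No condition is imposed on the scalar product outside the
  subspace.
\<close>

definition ip_norm :: "('w \<Rightarrow> 'w \<Rightarrow> real) \<Rightarrow> 'w \<Rightarrow> real" where
  "ip_norm a x = sqrt (a x x)"

locale scalar_product_space =
  fixes V :: "'w::real_vector set" and a :: "'w \<Rightarrow> 'w \<Rightarrow> real"
  assumes subspace: "subspace V"
    and sym: "x \<in> V \<Longrightarrow> y \<in> V \<Longrightarrow> a x y = a y x"
    and add_left: "x \<in> V \<Longrightarrow> y \<in> V \<Longrightarrow> z \<in> V \<Longrightarrow> a (x + y) z = a x z + a y z"
    and scale_left: "x \<in> V \<Longrightarrow> y \<in> V \<Longrightarrow> a (c *\<^sub>R x) y = c * a x y"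
    and pos_def: "x \<in> V \<Longrightarrow> x \<noteq> 0 \<Longrightarrow> 0 < a x x"

text \<open>
  The value 0 off the carrier is needed because the locale \<open>Metric_space\<close> asks for
  nonnegativity and symmetry of the distance on the whole type.
\<close>

definition ip_dist :: "'w::real_vector set \<Rightarrow> ('w \<Rightarrow> 'w \<Rightarrow> real) \<Rightarrow> 'w \<Rightarrow> 'w \<Rightarrow> real" where
  "ip_dist V a x y = (if x \<in> V \<and> y \<in> V then ip_norm a (x - y) else 0)"

locale separable_hilbert_space = scalar_product_space +
  assumes complete: "Metric_space.mcomplete V (ip_dist V a)"
    and separable: "separable_space (Metric_space.mtopology V (ip_dist V a))"

context scalar_product_space
begin

lemma zero_left: "y \<in> V \<Longrightarrow> a 0 y = 0"
  using scale_left[of 0 y 0] subspace_0[OF subspace] by simp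

lemma nonneg: "x \<in> V \<Longrightarrow> 0 \<le> a x x"
  using pos_def[of x] zero_left[of 0] subspace_0[OF subspace] by (cases "x = 0") auto

lemma expand:
  assumes "x \<in> V" "y \<in> V"
  shows "a (x + c *\<^sub>R y) (x + c *\<^sub>R y) = a x x + 2 * c * a x y + c\<^sup>2 * a y y"
proof -
  have cy: "c *\<^sub>R y \<in> V" and s: "x + c *\<^sub>R y \<in> V"
    using assms subspace by (auto simp: subspace_scale subspace_add)
  have 1: "a x (x + c *\<^sub>R y) = a x x + c * a x y"
    using assms cy s by (simp add: sym[OF assms(1) s] add_left scale_left sym[of y x])
  have 2: "a y (x + c *\<^sub>R y) = a x y + c * a y y"
    using assms cy s by (simp add: sym[OF assms(2) s] add_left scale_left)
  show ?thesis
    using assms cy s by (simp add: add_left scale_left 1 2 power2_eq_square algebra_simps)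
qed

lemma Cauchy_Schwarz:
  assumes "x \<in> V" "y \<in> V"
  shows "a x y \<le> ip_norm a x * ip_norm a y"
proof (cases "y = 0")
  case True
  then show ?thesis
    using assms sym[of x 0] zero_left by (simp add: ip_norm_def)
next
  case False
  then have p: "0 < a y y" using assms pos_def by blast
  define c where "c = - a x y / a y y"
  have "x + c *\<^sub>R y \<in> V" using assms subspace by (simp add: subspace_scale subspace_add)
  then have "0 \<le> a x x + 2 * c * a x y + c\<^sup>2 * a y y"
    using nonneg expand[OF assms] by metis
  also have "\<dots> = a x x - (a x y)\<^sup>2 / a y y"
    using p by (simp add: c_def field_simps power2_eq_square)
  finally have "(a x y)\<^sup>2 \<le> a x x * a y y" using p by (simp add: field_simps)
  then have "\<bar>a x y\<bar> \<le> sqrt (a x x * a y y)"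
    by (metis real_sqrt_abs real_sqrt_le_iff)
  then show ?thesis by (simp add: ip_norm_def real_sqrt_mult)
qed

lemma ip_norm_triangle:
  assumes "x \<in> V" "y \<in> V"
  shows "ip_norm a (x + y) \<le> ip_norm a x + ip_norm a y"
proof -
  have n: "0 \<le> ip_norm a x" "0 \<le> ip_norm a y" "(ip_norm a x)\<^sup>2 = a x x" "(ip_norm a y)\<^sup>2 = a y y"
    using assms nonneg by (auto simp: ip_norm_def)
  have "a (x + y) (x + y) = a x x + 2 * a x y + a y y"
    using expand[OF assms, of 1] by simp
  also have "\<dots> \<le> (ip_norm a x + ip_norm a y)\<^sup>2"
    using Cauchy_Schwarz[OF assms] n by (simp add: power2_sum)
  finally show ?thesis using n unfolding ip_norm_def[of _ "x + y"]
    by (intro real_le_lsqrt) auto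
qed

lemma Metric_space_ip_dist: "Metric_space V (ip_dist V a)"
proof
  have diff: "x - y \<in> V" if "x \<in> V" "y \<in> V" for x y
    using that subspace by (simp add: subspace_diff)
  fix x y
  show "0 \<le> ip_dist V a x y"
    using nonneg diff by (simp add: ip_dist_def ip_norm_def)
  show "ip_dist V a x y = ip_dist V a y x"
  proof (cases "x \<in> V \<and> y \<in> V")
    case True
    then have "a (y - x) (y - x) = a (x - y) (x - y)"
      using expand[of 0 "x - y" "-1"] diff[of x y] zero_left subspace_0[OF subspace] by simp
    then show ?thesis using True by (simp add: ip_dist_def ip_norm_def)
  qed (auto simp: ip_dist_def)
  show "ip_dist V a x y = 0 \<longleftrightarrow> x = y" if "x \<in> V" "y \<in> V"
  proof -
    have "a (x - y) (x - y) = 0 \<longleftrightarrow> x - y = 0"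
      using pos_def[OF diff[OF that]] zero_left[of 0] subspace_0[OF subspace] by fastforce
    then show ?thesis using that by (simp add: ip_dist_def ip_norm_def)
  qed
  fix z
  show "ip_dist V a x z \<le> ip_dist V a x y + ip_dist V a y z" if "x \<in> V" "y \<in> V" "z \<in> V"
    using that ip_norm_triangle[OF diff[of x y] diff[of y z]] by (simp add: ip_dist_def)
qed

end

definition linear_on_subspace ::
    "'w::real_vector set \<Rightarrow> ('w \<Rightarrow> 'v::real_vector) \<Rightarrow> bool" where
  "linear_on_subspace V R \<longleftrightarrow>
     (\<forall>x\<in>V. \<forall>y\<in>V. R (x + y) = R x + R y) \<and> (\<forall>c. \<forall>x\<in>V. R (c *\<^sub>R x) = c *\<^sub>R R x)"

text \<open>
  The exponent is an extended number; only \<open>q > 0\<close> is meaningful. The real-valued norm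
  is to be used together with the membership predicate.
\<close>

definition in_lq :: "ennreal \<Rightarrow> (nat \<Rightarrow> real) \<Rightarrow> bool" where
  "in_lq q x \<longleftrightarrow>
     (if q = \<infinity> then bdd_above (range (\<lambda>i. \<bar>x i\<bar>)) else summable (\<lambda>i. \<bar>x i\<bar> powr enn2real q))"

definition lq_norm :: "ennreal \<Rightarrow> (nat \<Rightarrow> real) \<Rightarrow> real" where
  "lq_norm q x =
     (if q = \<infinity> then (SUP i. \<bar>x i\<bar>) else (\<Sum>i. \<bar>x i\<bar> powr enn2real q) powr (1 / enn2real q))"

definition A2_reps ::
    "(nat \<Rightarrow> 'w set) \<Rightarrow> (nat \<Rightarrow> 'w \<Rightarrow> 'w \<Rightarrow> real) \<Rightarrow> (nat \<Rightarrow> 'w \<Rightarrow> 'v::real_normed_vector)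
     \<Rightarrow> (nat \<Rightarrow> real) \<Rightarrow> 'v \<Rightarrow> (nat \<Rightarrow> 'w) set" where
  "A2_reps V a R \<rho> u =
     {v. (\<forall>i. v i \<in> V i) \<and> (\<lambda>i. \<rho> i *\<^sub>R R i (v i)) sums u \<and>
         summable (\<lambda>i. \<rho> i * (ip_norm (a i) (v i))\<^sup>2)}"

definition A2_class ::
    "(nat \<Rightarrow> 'w set) \<Rightarrow> (nat \<Rightarrow> 'w \<Rightarrow> 'w \<Rightarrow> real) \<Rightarrow> (nat \<Rightarrow> 'w \<Rightarrow> 'v::real_normed_vector)
     \<Rightarrow> (nat \<Rightarrow> real) \<Rightarrow> 'v set" where
  "A2_class V a R \<rho> = {u. A2_reps V a R \<rho> u \<noteq> {}}"

definition A2_norm ::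
    "(nat \<Rightarrow> 'w set) \<Rightarrow> (nat \<Rightarrow> 'w \<Rightarrow> 'w \<Rightarrow> real) \<Rightarrow> (nat \<Rightarrow> 'w \<Rightarrow> 'v::real_normed_vector)
     \<Rightarrow> (nat \<Rightarrow> real) \<Rightarrow> 'v \<Rightarrow> real" where
  "A2_norm V a R \<rho> u =
     sqrt (INF v\<in>A2_reps V a R \<rho> u. \<Sum>i. \<rho> i * (ip_norm (a i) (v i))\<^sup>2)"

definition Aq_reps ::
    "(nat \<Rightarrow> 'w set) \<Rightarrow> (nat \<Rightarrow> 'w \<Rightarrow> 'w \<Rightarrow> real) \<Rightarrow> (nat \<Rightarrow> 'w \<Rightarrow> 'v::real_normed_vector)
     \<Rightarrow> (nat \<Rightarrow> real) \<Rightarrow> ennreal \<Rightarrow> 'v \<Rightarrow> (nat \<Rightarrow> 'w) set" where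
  "Aq_reps V a R \<gamma> q u =
     {w. (\<forall>i. w i \<in> V i) \<and> (\<lambda>i. R i (w i)) sums u \<and>
         in_lq q (\<lambda>i. inverse (\<gamma> i) * ip_norm (a i) (w i))}"

definition Aq_class ::
    "(nat \<Rightarrow> 'w set) \<Rightarrow> (nat \<Rightarrow> 'w \<Rightarrow> 'w \<Rightarrow> real) \<Rightarrow> (nat \<Rightarrow> 'w \<Rightarrow> 'v::real_normed_vector)
     \<Rightarrow> (nat \<Rightarrow> real) \<Rightarrow> ennreal \<Rightarrow> 'v set" where
  "Aq_class V a R \<gamma> q = {u. Aq_reps V a R \<gamma> q u \<noteq> {}}"

definition Aq_norm ::
    "(nat \<Rightarrow> 'w set) \<Rightarrow> (nat \<Rightarrow> 'w \<Rightarrow> 'w \<Rightarrow> real) \<Rightarrow> (nat \<Rightarrow> 'w \<Rightarrow> 'v::real_normed_vector)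
     \<Rightarrow> (nat \<Rightarrow> real) \<Rightarrow> ennreal \<Rightarrow> 'v \<Rightarrow> real" where
  "Aq_norm V a R \<gamma> q u =
     (INF w\<in>Aq_reps V a R \<gamma> q u. lq_norm q (\<lambda>i. inverse (\<gamma> i) * ip_norm (a i) (w i)))"

definition embeds_norm_le_1 ::
    "'v set \<Rightarrow> ('v \<Rightarrow> real) \<Rightarrow> 'v set \<Rightarrow> ('v \<Rightarrow> real) \<Rightarrow> bool" where
  "embeds_norm_le_1 X nX Y nY \<longleftrightarrow> (\<forall>u\<in>X. u \<in> Y \<and> nY u \<le> nX u)"

definition eq_norm_le_1 ::
    "'v set \<Rightarrow> ('v \<Rightarrow> real) \<Rightarrow> 'v set \<Rightarrow> ('v \<Rightarrow> real) \<Rightarrow> bool" where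
  "eq_norm_le_1 X nX Y nY \<longleftrightarrow> embeds_norm_le_1 X nX Y nY \<and> embeds_norm_le_1 Y nY X nX"

end

theory Submission
  imports Defs
begin

text \<open>
  All four norms are infima over representations, so it suffices to compare them representation by
  representation. In the two outer inclusions a representation \<open>u = \<Sum>i. R i (w i)\<close> is kept as
  it is, and with \<open>x i = \<parallel>w i\<parallel>\<close> only weighted sequence norms have to be compared. Both
  comparisons use that \<open>\<rho>\<close> has total mass 1: if \<open>\<bar>x i\<bar> \<le> M * \<rho> i\<close>, then
  \<open>\<Sum>i. (x i)\<^sup>2 / \<rho> i \<le> M\<^sup>2 * (\<Sum>i. \<rho> i) = M\<^sup>2\<close> (\<open>weighted_l_infinity_le_l2\<close>), and
  by Cauchy--Schwarz
  \<open>\<Sum>i. \<bar>x i\<bar> = \<Sum>i. sqrt (\<rho> i) * (\<bar>x i\<bar> / sqrt (\<rho> i)) \<le> sqrt (\<Sum>i. (x i)\<^sup>2 / \<rho> i)\<close>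
  (\<open>weighted_l2_le_l1\<close>).

  The equality in the middle is the substitution \<open>w i = \<rho> i *\<^sub>R v i\<close>: it carries the
  representations that define \<open>A\<^sub>2\<close> onto those that define the class with weight
  \<open>sqrt \<rho>\<close> and exponent 2 (\<open>scale_image_A2_reps\<close>), and it satisfies
  \<open>(\<parallel>w i\<parallel> / sqrt (\<rho> i))\<^sup>2 = \<rho> i * \<parallel>v i\<parallel>\<^sup>2\<close>. The two norms then differ only in whether
  the square root is taken outside or inside the infimum.
\<close>

section \<open>The sequence norms for the exponents 1 and 2\<close>

lemma in_lq_2_iff: "in_lq 2 x \<longleftrightarrow> summable (\<lambda>i. (x i)\<^sup>2)"
  by (simp add: in_lq_def powr_numeral)

lemma lq_norm_2: "lq_norm 2 x = sqrt (\<Sum>i. (x i)\<^sup>2)" if "in_lq 2 x"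
  using that
  by (simp add: in_lq_2_iff lq_norm_def powr_numeral powr_half_sqrt suminf_nonneg)

lemma in_lq_1_iff: "in_lq 1 x \<longleftrightarrow> summable (\<lambda>i. \<bar>x i\<bar>)"
  by (simp add: in_lq_def)

lemma lq_norm_1: "lq_norm 1 x = (\<Sum>i. \<bar>x i\<bar>)" if "in_lq 1 x"
  using that by (simp add: in_lq_1_iff lq_norm_def suminf_nonneg)

lemma lq_norm_nonneg: "0 \<le> lq_norm q x" if "in_lq q x"
proof (cases "q = \<infinity>")
  case True
  then have "\<bar>x 0\<bar> \<le> lq_norm q x"
    using that by (auto simp: in_lq_def lq_norm_def intro!: cSUP_upper)
  then show ?thesis by linarith
qed (simp add: lq_norm_def)

lemma Cauchy_Schwarz_series:
  fixes f g :: "nat \<Rightarrow> real"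
  assumes "summable (\<lambda>i. (f i)\<^sup>2)" "summable (\<lambda>i. (g i)\<^sup>2)"
  shows "summable (\<lambda>i. \<bar>f i * g i\<bar>)"
    and "(\<Sum>i. \<bar>f i * g i\<bar>) \<le> sqrt (\<Sum>i. (f i)\<^sup>2) * sqrt (\<Sum>i. (g i)\<^sup>2)"
proof -
  have L2_le: "L2_set h {..<n} \<le> sqrt (\<Sum>i. (h i)\<^sup>2)" if "summable (\<lambda>i. (h i)\<^sup>2)"
    for h :: "nat \<Rightarrow> real" and n
    using that by (auto simp: L2_set_def intro: sum_le_suminf)
  have bound: "(\<Sum>i<n. \<bar>f i * g i\<bar>) \<le> sqrt (\<Sum>i. (f i)\<^sup>2) * sqrt (\<Sum>i. (g i)\<^sup>2)" for n
  proof -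
    have "(\<Sum>i<n. \<bar>f i * g i\<bar>) \<le> L2_set f {..<n} * L2_set g {..<n}"
      using L2_set_mult_ineq[of f g "{..<n}"] by (simp add: abs_mult)
    also have "\<dots> \<le> sqrt (\<Sum>i. (f i)\<^sup>2) * sqrt (\<Sum>i. (g i)\<^sup>2)"
      using assms by (intro mult_mono L2_le) (auto simp: suminf_nonneg)
    finally show ?thesis .
  qed
  show "summable (\<lambda>i. \<bar>f i * g i\<bar>)"
    by (rule summableI_nonneg_bounded[OF _ bound]) simp
  then show "(\<Sum>i. \<bar>f i * g i\<bar>) \<le> sqrt (\<Sum>i. (f i)\<^sup>2) * sqrt (\<Sum>i. (g i)\<^sup>2)"
    by (rule suminf_le_const[OF _ bound])
qed

section \<open>Weighted sequence norms for a weight of total mass 1\<close>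

lemma weighted_l_infinity_le_l2:
  fixes \<rho> x :: "nat \<Rightarrow> real"
  assumes pos: "\<And>i. \<rho> i > 0" and mass: "\<rho> sums 1"
    and x: "in_lq \<infinity> (\<lambda>i. inverse (\<rho> i) * x i)"
  shows "in_lq 2 (\<lambda>i. inverse (sqrt (\<rho> i)) * x i) \<and>
    lq_norm 2 (\<lambda>i. inverse (sqrt (\<rho> i)) * x i) \<le> lq_norm \<infinity> (\<lambda>i. inverse (\<rho> i) * x i)"
proof -
  define M where "M = lq_norm \<infinity> (\<lambda>i. inverse (\<rho> i) * x i)"
  have M_nonneg: "0 \<le> M" unfolding M_def by (rule lq_norm_nonneg[OF x])
  have le_M: "\<bar>inverse (\<rho> i) * x i\<bar> \<le> M" for i
    using x unfolding M_def by (auto simp: in_lq_def lq_norm_def intro!: cSUP_upper)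
  have term_le: "(inverse (sqrt (\<rho> i)) * x i)\<^sup>2 \<le> M\<^sup>2 * \<rho> i" for i
  proof -
    have "(inverse (sqrt (\<rho> i)) * x i)\<^sup>2 = (inverse (\<rho> i) * x i)\<^sup>2 * \<rho> i"
      using pos[of i] by (simp add: power_mult_distrib power_inverse field_simps power2_eq_square)
    also have "\<dots> \<le> M\<^sup>2 * \<rho> i"
      using le_M[of i] pos[of i] M_nonneg
      by (intro mult_right_mono) (auto simp: abs_le_square_iff[symmetric])
    finally show ?thesis .
  qed
  have major: "(\<lambda>i. M\<^sup>2 * \<rho> i) sums M\<^sup>2"
    using sums_mult[OF mass, of "M\<^sup>2"] by simp
  have summable: "summable (\<lambda>i. (inverse (sqrt (\<rho> i)) * x i)\<^sup>2)"
    by (rule summable_comparison_test[OF _ sums_summable[OF major]]) (use term_le in auto)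
  have "(\<Sum>i. (inverse (sqrt (\<rho> i)) * x i)\<^sup>2) \<le> M\<^sup>2"
    using suminf_le[OF term_le summable sums_summable[OF major]] sums_unique[OF major] by simp
  then have "sqrt (\<Sum>i. (inverse (sqrt (\<rho> i)) * x i)\<^sup>2) \<le> M"
    using M_nonneg by (rule real_le_lsqrt[rotated])
  then show ?thesis
    using summable lq_norm_2 in_lq_2_iff M_def by metis
qed

lemma weighted_l2_le_l1:
  fixes \<rho> x :: "nat \<Rightarrow> real"
  assumes pos: "\<And>i. \<rho> i > 0" and mass: "\<rho> sums 1"
    and x: "in_lq 2 (\<lambda>i. inverse (sqrt (\<rho> i)) * x i)"
  shows "in_lq 1 x \<and> lq_norm 1 x \<le> lq_norm 2 (\<lambda>i. inverse (sqrt (\<rho> i)) * x i)"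
proof -
  have sqrt_sq: "(sqrt (\<rho> i))\<^sup>2 = \<rho> i" for i using pos[of i] by simp
  have split: "sqrt (\<rho> i) * (inverse (sqrt (\<rho> i)) * x i) = x i" for i
    using pos[of i] by simp
  have sqrt_sq_summable: "summable (\<lambda>i. (sqrt (\<rho> i))\<^sup>2)"
    unfolding sqrt_sq using mass by (rule sums_summable)
  note CS = Cauchy_Schwarz_series[OF sqrt_sq_summable x[unfolded in_lq_2_iff]]
  have "in_lq 1 x" using CS(1) by (simp only: split in_lq_1_iff)
  moreover have "(\<Sum>i. \<bar>x i\<bar>) \<le> sqrt (\<Sum>i. (inverse (sqrt (\<rho> i)) * x i)\<^sup>2)"
    using CS(2) unfolding split sqrt_sq sums_unique[OF mass, symmetric] by simp
  ultimately show ?thesis by (simp only: lq_norm_1 lq_norm_2[OF x])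
qed

section \<open>Passing to the infimum over representations\<close>

text \<open>
  The same representation serves in both classes, so a bound between the weighted sequence norms
  alone gives the embedding.
\<close>

lemma Aq_embeds_if_weighted_lq_le:
  assumes le: "\<And>x. in_lq q (\<lambda>i. inverse (\<gamma> i) * x i) \<Longrightarrow>
      in_lq p (\<lambda>i. inverse (\<delta> i) * x i) \<and>
      lq_norm p (\<lambda>i. inverse (\<delta> i) * x i) \<le> lq_norm q (\<lambda>i. inverse (\<gamma> i) * x i)"
  shows "embeds_norm_le_1 (Aq_class V a R \<gamma> q) (Aq_norm V a R \<gamma> q)
           (Aq_class V a R \<delta> p) (Aq_norm V a R \<delta> p)"
  unfolding embeds_norm_le_1_def
proof (intro ballI conjI)
  fix u assume u: "u \<in> Aq_class V a R \<gamma> q"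
  have sub: "Aq_reps V a R \<gamma> q u \<subseteq> Aq_reps V a R \<delta> p u"
    using le by (auto simp: Aq_reps_def)
  then show "u \<in> Aq_class V a R \<delta> p" using u by (auto simp: Aq_class_def)
  show "Aq_norm V a R \<delta> p u \<le> Aq_norm V a R \<gamma> q u"
    unfolding Aq_norm_def
  proof (rule cINF_mono)
    show "Aq_reps V a R \<gamma> q u \<noteq> {}" using u by (simp add: Aq_class_def)
    show "bdd_below ((\<lambda>w. lq_norm p (\<lambda>i. inverse (\<delta> i) * ip_norm (a i) (w i))) `
        Aq_reps V a R \<delta> p u)"
      by (rule bdd_belowI2[of _ 0]) (simp add: Aq_reps_def lq_norm_nonneg)
  next
    fix w assume w: "w \<in> Aq_reps V a R \<gamma> q u"
    then have "in_lq q (\<lambda>i. inverse (\<gamma> i) * ip_norm (a i) (w i))" by (simp add: Aq_reps_def)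
    then have "lq_norm p (\<lambda>i. inverse (\<delta> i) * ip_norm (a i) (w i))
        \<le> lq_norm q (\<lambda>i. inverse (\<gamma> i) * ip_norm (a i) (w i))"
      using le by simp
    then show "\<exists>w'\<in>Aq_reps V a R \<delta> p u.
        lq_norm p (\<lambda>i. inverse (\<delta> i) * ip_norm (a i) (w' i))
        \<le> lq_norm q (\<lambda>i. inverse (\<gamma> i) * ip_norm (a i) (w i))"
      using sub w by blast
  qed
qed

section \<open>The two descriptions of the class with exponent 2\<close>

lemma (in scalar_product_space) ip_norm_scale:
  assumes "x \<in> V"
  shows "ip_norm a (c *\<^sub>R x) = \<bar>c\<bar> * ip_norm a x"
proof -
  have cx: "c *\<^sub>R x \<in> V" using assms subspace by (simp add: subspace_scale)
  have "a (c *\<^sub>R x) (c *\<^sub>R x) = c\<^sup>2 * a x x"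
    using assms cx by (simp add: scale_left sym[OF assms cx] power2_eq_square)
  then show ?thesis by (simp add: ip_norm_def real_sqrt_mult)
qed

text \<open>
  The factor \<open>r\<^sup>2\<close> produced by the scaling loses one power of \<open>r\<close> to the weight. This is why
  \<open>sqrt \<rho>\<close>, and not \<open>\<rho>\<close>, is the weight matching \<open>A\<^sub>2\<close>.
\<close>

lemma weighted_ip_norm_scale_sq:
  assumes "scalar_product_space W b" "x \<in> W" "r > 0"
  shows "(inverse (sqrt r) * ip_norm b (r *\<^sub>R x))\<^sup>2 = r * (ip_norm b x)\<^sup>2"
  using assms(3)
  by (simp add: scalar_product_space.ip_norm_scale[OF assms(1,2)] power_mult_distrib
      power_inverse power2_eq_square[of r] del: times_divide_eq_right)

lemma scale_image_A2_reps:
  fixes \<rho> :: "nat \<Rightarrow> real"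
  assumes V: "\<And>i. scalar_product_space (V i) (a i)"
    and R: "\<And>i. linear_on_subspace (V i) (R i)"
    and pos: "\<And>i. \<rho> i > 0"
  shows "(\<lambda>v i. \<rho> i *\<^sub>R v i) ` A2_reps V a R \<rho> u = Aq_reps V a R (\<lambda>i. sqrt (\<rho> i)) 2 u"
proof -
  have scale_mem: "c *\<^sub>R x \<in> V i" if "x \<in> V i" for c x i
    using that scalar_product_space.subspace[OF V] by (simp add: subspace_scale)
  have rep_iff: "(\<lambda>i. \<rho> i *\<^sub>R v i) \<in> Aq_reps V a R (\<lambda>i. sqrt (\<rho> i)) 2 u \<longleftrightarrow>
      v \<in> A2_reps V a R \<rho> u" if v: "\<And>i. v i \<in> V i" for v
  proof -
    have "R i (\<rho> i *\<^sub>R v i) = \<rho> i *\<^sub>R R i (v i)" for i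
      using R[of i] v[of i] by (simp add: linear_on_subspace_def)
    then show ?thesis
      using v by (simp add: Aq_reps_def A2_reps_def scale_mem in_lq_2_iff
          weighted_ip_norm_scale_sq[OF V v pos])
  qed
  show ?thesis
  proof (intro subset_antisym subsetI)
    fix w assume "w \<in> (\<lambda>v i. \<rho> i *\<^sub>R v i) ` A2_reps V a R \<rho> u"
    then obtain v where v: "v \<in> A2_reps V a R \<rho> u" and w: "w = (\<lambda>i. \<rho> i *\<^sub>R v i)" by blast
    have "v i \<in> V i" for i using v by (simp add: A2_reps_def)
    then show "w \<in> Aq_reps V a R (\<lambda>i. sqrt (\<rho> i)) 2 u" using rep_iff v w by blast
  next
    fix w assume w: "w \<in> Aq_reps V a R (\<lambda>i. sqrt (\<rho> i)) 2 u"
    define v where "v = (\<lambda>i. inverse (\<rho> i) *\<^sub>R w i)"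
    have v_mem: "v i \<in> V i" for i using w by (simp add: v_def Aq_reps_def scale_mem)
    have "w = (\<lambda>i. \<rho> i *\<^sub>R v i)"
      using pos by (simp add: v_def less_imp_neq[THEN not_sym])
    then show "w \<in> (\<lambda>v i. \<rho> i *\<^sub>R v i) ` A2_reps V a R \<rho> u"
      using rep_iff[OF v_mem] w by blast
  qed
qed

lemma A2_class_eq_Aq_class:
  assumes "\<And>i. scalar_product_space (V i) (a i)"
    and "\<And>i. linear_on_subspace (V i) (R i)"
    and "\<And>i. (\<rho> i :: real) > 0"
  shows "A2_class V a R \<rho> = Aq_class V a R (\<lambda>i. sqrt (\<rho> i)) 2"
  by (simp add: A2_class_def Aq_class_def scale_image_A2_reps[OF assms, symmetric])

text \<open>
  The square root, being increasing and continuous, may be moved inside the infimum; the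
  substitution \<open>w i = \<rho> i *\<^sub>R v i\<close> then only changes the set over which the infimum runs.
\<close>

lemma A2_norm_eq_Aq_norm:
  assumes V: "\<And>i. scalar_product_space (V i) (a i)"
    and R: "\<And>i. linear_on_subspace (V i) (R i)"
    and pos: "\<And>i. \<rho> i > 0"
    and u: "u \<in> A2_class V a R \<rho>"
  shows "A2_norm V a R \<rho> u = Aq_norm V a R (\<lambda>i. sqrt (\<rho> i)) 2 u"
proof -
  define S where "S v = (\<Sum>i. \<rho> i * (ip_norm (a i) (v i))\<^sup>2)" for v
  have norm_eq: "lq_norm 2 (\<lambda>i. inverse (sqrt (\<rho> i)) * ip_norm (a i) (\<rho> i *\<^sub>R v i)) = sqrt (S v)"
    if v: "v \<in> A2_reps V a R \<rho> u" for v
  proof -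
    have v_mem: "v i \<in> V i" for i using v by (simp add: A2_reps_def)
    note sq = weighted_ip_norm_scale_sq[OF V v_mem pos]
    have "in_lq 2 (\<lambda>i. inverse (sqrt (\<rho> i)) * ip_norm (a i) (\<rho> i *\<^sub>R v i))"
      using v by (simp add: in_lq_2_iff sq A2_reps_def)
    then show ?thesis by (simp add: lq_norm_2 sq S_def)
  qed
  have "A2_norm V a R \<rho> u = sqrt (Inf (S ` A2_reps V a R \<rho> u))"
    by (simp add: A2_norm_def S_def)
  also have "\<dots> = (INF s\<in>S ` A2_reps V a R \<rho> u. sqrt s)"
  proof (rule continuous_at_Inf_mono)
    show "mono sqrt" by (simp add: mono_def)
    show "continuous (at_right (Inf (S ` A2_reps V a R \<rho> u))) sqrt"
      by (rule continuous_at_imp_continuous_at_within[OF isCont_real_sqrt])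
    show "S ` A2_reps V a R \<rho> u \<noteq> {}" using u by (simp add: A2_class_def)
    show "bdd_below (S ` A2_reps V a R \<rho> u)"
      by (rule bdd_belowI2[of _ 0])
        (auto simp: S_def A2_reps_def pos less_imp_le intro!: suminf_nonneg)
  qed
  also have "\<dots> = (INF v\<in>A2_reps V a R \<rho> u.
      lq_norm 2 (\<lambda>i. inverse (sqrt (\<rho> i)) * ip_norm (a i) (\<rho> i *\<^sub>R v i)))"
    by (simp add: image_image norm_eq cong: image_cong)
  also have "\<dots> = Aq_norm V a R (\<lambda>i. sqrt (\<rho> i)) 2 u"
    by (simp add: Aq_norm_def scale_image_A2_reps[OF V R pos, symmetric] image_image)
  finally show ?thesis .
qed

section \<open>The embeddings\<close>

lemma pmf_nat_sums_1: "pmf (p :: nat pmf) sums 1"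
proof -
  have "(\<lambda>i. measure p {i}) sums measure p (\<Union>i. {i})"
    by (rule measure_pmf.finite_measure_UNION) (auto simp: disjoint_family_on_def)
  then show ?thesis by (simp add: measure_pmf_single)
qed

theorem lemma1:
  fixes V :: "nat \<Rightarrow> 'w::real_vector set"
    and a :: "nat \<Rightarrow> 'w \<Rightarrow> 'w \<Rightarrow> real"
    and R :: "nat \<Rightarrow> 'w \<Rightarrow> 'v::{real_inner, complete_space}"
    and \<Lambda> :: real
    and \<rho> :: "nat pmf"
  assumes "separable_space (euclidean :: 'v topology)"
    and "\<And>i. separable_hilbert_space (V i) (a i)"
    and "\<And>i. linear_on_subspace (V i) (R i)"
    and "\<And>i. {v \<in> V i. R i v = 0} = {0}"
    and "\<And>i v. v \<in> V i \<Longrightarrow> ip_norm (a i) v = 1 \<Longrightarrow> norm (R i v) \<le> \<Lambda>"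
    and "\<And>i. pmf \<rho> i > 0"
  shows "embeds_norm_le_1
           (Aq_class V a R (pmf \<rho>) \<infinity>) (Aq_norm V a R (pmf \<rho>) \<infinity>)
           (A2_class V a R (pmf \<rho>)) (A2_norm V a R (pmf \<rho>))
       \<and> eq_norm_le_1
           (A2_class V a R (pmf \<rho>)) (A2_norm V a R (pmf \<rho>))
           (Aq_class V a R (\<lambda>i. sqrt (pmf \<rho> i)) 2) (Aq_norm V a R (\<lambda>i. sqrt (pmf \<rho> i)) 2)
       \<and> embeds_norm_le_1
           (Aq_class V a R (\<lambda>i. sqrt (pmf \<rho> i)) 2) (Aq_norm V a R (\<lambda>i. sqrt (pmf \<rho> i)) 2)
           (Aq_class V a R (\<lambda>i. 1) 1) (Aq_norm V a R (\<lambda>i. 1) 1)"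
proof -
  have V: "\<And>i. scalar_product_space (V i) (a i)"
    using assms(2) by (simp add: separable_hilbert_space_def)
  note weight = assms(6) pmf_nat_sums_1[of \<rho>]
  note class_eq = A2_class_eq_Aq_class[OF V assms(3,6)]
  note norm_eq = A2_norm_eq_Aq_norm[OF V assms(3,6)]
  have eq: "eq_norm_le_1
      (A2_class V a R (pmf \<rho>)) (A2_norm V a R (pmf \<rho>))
      (Aq_class V a R (\<lambda>i. sqrt (pmf \<rho> i)) 2) (Aq_norm V a R (\<lambda>i. sqrt (pmf \<rho> i)) 2)"
    using class_eq norm_eq by (simp add: eq_norm_le_1_def embeds_norm_le_1_def)
  have "embeds_norm_le_1
      (Aq_class V a R (pmf \<rho>) \<infinity>) (Aq_norm V a R (pmf \<rho>) \<infinity>)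
      (Aq_class V a R (\<lambda>i. sqrt (pmf \<rho> i)) 2) (Aq_norm V a R (\<lambda>i. sqrt (pmf \<rho> i)) 2)"
    by (rule Aq_embeds_if_weighted_lq_le) (rule weighted_l_infinity_le_l2[OF weight])
  then have "embeds_norm_le_1
      (Aq_class V a R (pmf \<rho>) \<infinity>) (Aq_norm V a R (pmf \<rho>) \<infinity>)
      (A2_class V a R (pmf \<rho>)) (A2_norm V a R (pmf \<rho>))"
    using class_eq norm_eq by (simp add: embeds_norm_le_1_def)
  moreover have "embeds_norm_le_1
      (Aq_class V a R (\<lambda>i. sqrt (pmf \<rho> i)) 2) (Aq_norm V a R (\<lambda>i. sqrt (pmf \<rho> i)) 2)
      (Aq_class V a R (\<lambda>i. 1) 1) (Aq_norm V a R (\<lambda>i. 1) 1)"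
    by (rule Aq_embeds_if_weighted_lq_le) (use weighted_l2_le_l1[OF weight] in simp)
  ultimately show ?thesis using eq by blast
qed

end
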